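(* Let $D=\operatorname{diag}(2,2,1/4)$, $E_{12}=e_1\otimes e_2$, $F(s)=D+sE_{12}$, and $Z_*=\operatorname{diag}(191/4,191/4,0)$. For every real $s$ with $|s|\le1/4$, $$D^2W_{\rm MR}(F(s))+Z_*:D^2\operatorname{cof}\ \succ\ \tfrac15A_1(D),$$ that is, $D^2W_{\rm MR}(F(s))[H,H]+Z_*:(H\times H)>\tfrac15A_1(D)[H,H]$ for every nonzero $H\in\mathbb R^{3\times3}$. Moreover, the same coefficient $Z_*$ is exactly aligned with every quadratic reference map $X:\widehat T\to\mathbb R^3$ all of whose midside deviations lie in the third coordinate direction.
   Context: $A:B=\operatorname{tr}(A^TB)$; $\operatorname{cof}A$ is the matrix of signed $2\times2$ minors; $A\times B=\operatorname{cof}(A+B)-\operatorname{cof}A-\operatorname{cof}B$, so $D^2\operatorname{cof}[H,L]=H\times L$. $e_1,e_2,e_3$ are the Cartesian unit vectors. $W_{\rm MR}(F)=(J^{-2/3}F:F-3)+(J^{-4/3}\operatorname{cof}F:\operatorname{cof}F-3)$ with $J=\det F>0$. For $F$ with $\det F=J>0$, $\theta_H=F^{-T}:H$ and $I_1=F:F$, $$A_1(F)[H,L]=2J^{-2/3}\Bigl\{\bigl(H-\tfrac23\theta_HF\bigr):\bigl(L-\tfrac23\theta_LF\bigr)+\tfrac{I_1}{9}\theta_H\theta_L\Bigr\}.$$ Tetrahedral terms: $\widehat T=\{\xi\in\mathbb R^3:\xi_i\ge0,\ \sum\xi_i\le1\}$; a quadratic map has components in $\mathbb P_2$ (total degree at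 most 2); its midside deviation on the edge $ij$ is its value at the edge midpoint minus the average of its values at the two end vertices. $Q_4$ has weight $1/24$ at each of the four points with barycentric coordinates the permutations of $\bigl(\frac{5+3\sqrt5}{20},\frac{5-\sqrt5}{20},\frac{5-\sqrt5}{20},\frac{5-\sqrt5}{20}\bigr)$. A constant matrix $Z$ is exactly aligned with $X$ if $Q_4[D(ZX):(Du\times Dv)]=\int_{\widehat T}D(ZX):(Du\times Dv)\,d\xi$ for all $u,v\in[\mathbb P_2]^3$ ($D$ applied to a field being its Jacobian in $\xi$); equivalently $ZX$ is an affine map. *)

theory Defs
  imports "HOL-Analysis.Analysis"
begin

definition frob :: "real^3^3 \<Rightarrow> real^3^3 \<Rightarrow> real" where
  "frob A B = trace (transpose A ** B)"

definition diag3 :: "real \<Rightarrow> real \<Rightarrow> real \<Rightarrow> real^3^3" where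
  "diag3 a b c = vector [vector [a, 0, 0], vector [0, b, 0], vector [0, 0, c]]"

definition outer :: "real^3 \<Rightarrow> real^3 \<Rightarrow> real^3^3" where
  "outer u v = (\<chi> i j. u $ i * v $ j)"

definition cof :: "real^3^3 \<Rightarrow> real^3^3" where
  "cof A = vector [
     vector [   A$2$2 * A$3$3 - A$2$3 * A$3$2,  -(A$2$1 * A$3$3 - A$2$3 * A$3$1),   A$2$1 * A$3$2 - A$2$2 * A$3$1 ],
     vector [ -(A$1$2 * A$3$3 - A$1$3 * A$3$2),   A$1$1 * A$3$3 - A$1$3 * A$3$1,  -(A$1$1 * A$3$2 - A$1$2 * A$3$1)],
     vector [   A$1$2 * A$2$3 - A$1$3 * A$2$2,  -(A$1$1 * A$2$3 - A$1$3 * A$2$1),   A$1$1 * A$2$2 - A$1$2 * A$2$1 ]]"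

(* The tensor cross product A x B; it is the constant second derivative of cof in
   the directions A, B. *)
definition tcross :: "real^3^3 \<Rightarrow> real^3^3 \<Rightarrow> real^3^3" where
  "tcross A B = cof (A + B) - cof A - cof B"

(* D^2 f(x)[h, k] as an iterated Frechet derivative. It is meaningful only where f is
   twice differentiable; elsewhere frechet_derivative is an arbitrary value. *)
definition second_derivative ::
  "('a::real_normed_vector \<Rightarrow> 'b::real_normed_vector) \<Rightarrow> 'a \<Rightarrow> 'a \<Rightarrow> 'a \<Rightarrow> 'b" where
  "second_derivative f x h k =
     frechet_derivative (\<lambda>y. frechet_derivative f (at y) k) (at x) h"

(* Intended on the open set det F > 0; the powers are then the usual real ones. *)
definition W_MR :: "real^3^3 \<Rightarrow> real" where
  "W_MR F =
     (det F powr (-2/3) * frob F F - 3) + (det F powr (-4/3) * frob (cof F) (cof F) - 3)"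

definition theta :: "real^3^3 \<Rightarrow> real^3^3 \<Rightarrow> real" where
  "theta F H = frob (matrix_inv (transpose F)) H"

definition A1 :: "real^3^3 \<Rightarrow> real^3^3 \<Rightarrow> real^3^3 \<Rightarrow> real" where
  "A1 F H L = 2 * det F powr (-2/3) *
     (frob (H - (2/3 * theta F H) *\<^sub>R F) (L - (2/3 * theta F L) *\<^sub>R F)
      + frob F F / 9 * theta F H * theta F L)"

definition ref_tet :: "(real^3) set" where
  "ref_tet = {\<xi>. (\<forall>i. 0 \<le> \<xi> $ i) \<and> (\<Sum>i\<in>UNIV. \<xi> $ i) \<le> 1}"

definition tet_vertices :: "(real^3) set" where
  "tet_vertices = insert 0 (range (\<lambda>i. axis i 1))"

definition poly2 :: "(real^3 \<Rightarrow> real) set" where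
  "poly2 = {p. \<exists>a (b :: 3 \<Rightarrow> real) (c :: 3 \<Rightarrow> 3 \<Rightarrow> real). \<forall>\<xi>.
     p \<xi> = a + (\<Sum>i\<in>UNIV. b i * \<xi> $ i) + (\<Sum>i\<in>UNIV. \<Sum>j\<in>UNIV. c i j * \<xi> $ i * \<xi> $ j)}"

(* A quadratic map on the reference tetrahedron is represented by its unique polynomial
   extension to the whole space (the tetrahedron has nonempty interior), so that Jacobians
   at boundary points are ordinary ones. *)
definition quadratic_map :: "(real^3 \<Rightarrow> real^3) \<Rightarrow> bool" where
  "quadratic_map X \<longleftrightarrow> (\<forall>i. (\<lambda>\<xi>. X \<xi> $ i) \<in> poly2)"

definition midside_deviation :: "(real^3 \<Rightarrow> real^3) \<Rightarrow> real^3 \<Rightarrow> real^3 \<Rightarrow> real^3" where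
  "midside_deviation X p q = X (midpoint p q) - (1/2) *\<^sub>R (X p + X q)"

(* The node attached to the vertex v has barycentric coordinate (5 + 3 sqrt 5)/20 at v and
   (5 - sqrt 5)/20 at each of the other three vertices. *)
definition Q4 :: "(real^3 \<Rightarrow> real) \<Rightarrow> real" where
  "Q4 f = (\<Sum>v\<in>tet_vertices. 1/24 *
     f (\<Sum>w\<in>tet_vertices. (if w = v then (5 + 3 * sqrt 5) / 20 else (5 - sqrt 5) / 20) *\<^sub>R w))"

definition exactly_aligned :: "real^3^3 \<Rightarrow> (real^3 \<Rightarrow> real^3) \<Rightarrow> bool" where
  "exactly_aligned Z X \<longleftrightarrow> (\<forall>u v. quadratic_map u \<longrightarrow> quadratic_map v \<longrightarrow>
     (let g = (\<lambda>\<xi>. frob (jacobian (\<lambda>\<eta>. Z *v X \<eta>) (at \<xi>))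
                        (tcross (jacobian u (at \<xi>)) (jacobian v (at \<xi>))))
      in Q4 g = integral ref_tet g))"

end

theory Submission
  imports Defs
begin

text \<open>
  Since det F(s) = 1, the second derivative of the energy is polynomial in s, so the difference of the
  two sides of the stability inequality is an explicit quadratic form in the nine entries of H. Two
  exchange symmetries split it into the multiple of a square, two binary forms (with s and -s) and one
  form in four variables. The binary forms have negative discriminant for \<open>\<bar>s\<bar> \<le> 1/4\<close>, and
  completing two squares turns the last form into a binary form whose discriminant is again negative.

  If all midside deviations of X are vertical, then the first two components of X have no quadratic
  part, so ZX is affine. The integrand of the alignment identity is then a polynomial of degree at
  most two, and the four-point rule is exact on those.
\<close>

section \<open>The second derivative of the energy\<close>

lemma frob_eq_inner: "frob A B = A \<bullet> B"
  by (simp add: frob_def trace_def transpose_def matrix_matrix_mult_def inner_vec_def sum_3)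

section \<open>The tensor cross product as a symmetric bilinear map\<close>

lemma tcross_entries:
  "tcross A B = vector [
     vector [A$2$2 * B$3$3 + B$2$2 * A$3$3 - A$2$3 * B$3$2 - B$2$3 * A$3$2,
             A$2$3 * B$3$1 + B$2$3 * A$3$1 - A$2$1 * B$3$3 - B$2$1 * A$3$3,
             A$2$1 * B$3$2 + B$2$1 * A$3$2 - A$2$2 * B$3$1 - B$2$2 * A$3$1],
     vector [A$1$3 * B$3$2 + B$1$3 * A$3$2 - A$1$2 * B$3$3 - B$1$2 * A$3$3,
             A$1$1 * B$3$3 + B$1$1 * A$3$3 - A$1$3 * B$3$1 - B$1$3 * A$3$1,
             A$1$2 * B$3$1 + B$1$2 * A$3$1 - A$1$1 * B$3$2 - B$1$1 * A$3$2],
     vector [A$1$2 * B$2$3 + B$1$2 * A$2$3 - A$1$3 * B$2$2 - B$1$3 * A$2$2,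
             A$1$3 * B$2$1 + B$1$3 * A$2$1 - A$1$1 * B$2$3 - B$1$1 * A$2$3,
             A$1$1 * B$2$2 + B$1$1 * A$2$2 - A$1$2 * B$2$1 - B$1$2 * A$2$1]]"
  by (simp add: tcross_def cof_def vec_eq_iff forall_3 algebra_simps)

lemma bounded_bilinear_tcross: "bounded_bilinear tcross"
  unfolding bilinear_conv_bounded_bilinear[symmetric] bilinear_def
  by (intro conjI allI linearI)
    (simp_all add: tcross_entries vec_eq_iff forall_3 algebra_simps)


lemma tcross_zero [simp]: "tcross A 0 = 0" "tcross 0 A = 0"
  by (simp_all add: bounded_bilinear.zero_left bounded_bilinear.zero_right bounded_bilinear_tcross)

lemma tcross_commute: "tcross A B = tcross B A"
  by (simp add: tcross_def add.commute)

lemma cof_eq_tcross: "cof A = (1/2) *\<^sub>R tcross A A"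
  by (simp add: tcross_entries cof_def vec_eq_iff forall_3 algebra_simps)

text \<open>Euler's identity for a cubic form: \<open>cof A\<close> is the gradient of
  \<open>det\<close>, so \<open>cof A \<bullet> A\<close> is \<open>3 * det A\<close>. Written this
  way, the determinant can be differentiated by the bilinear product rule alone.\<close>

lemma det_eq_tcross: "det A = (1/6) * (tcross A A \<bullet> A)" for A :: "real^3^3"
  by (simp add: tcross_entries det_3 inner_vec_def sum_3 algebra_simps)

text \<open>Together with \<open>tcross_commute\<close> this makes
  \<open>tcross A B \<bullet> C\<close> totally symmetric: it is the symmetric trilinear form whose
  diagonal is \<open>6 * det\<close>.\<close>

lemma inner_tcross_rotate: "tcross A B \<bullet> C = tcross A C \<bullet> B"
  by (simp add: tcross_entries inner_vec_def sum_3 algebra_simps)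

lemmas has_derivative_tcross [derivative_intros] =
  bounded_bilinear.FDERIV[OF bounded_bilinear_tcross]

lemma has_derivative_cof [derivative_intros]:
  assumes "(f has_derivative f') (at x within S)"
  shows "((\<lambda>x. cof (f x)) has_derivative (\<lambda>h. tcross (f x) (f' h))) (at x within S)"
proof -
  have "((\<lambda>x. (1/2) *\<^sub>R tcross (f x) (f x)) has_derivative
      (\<lambda>h. (1/2) *\<^sub>R (tcross (f x) (f' h) + tcross (f' h) (f x)))) (at x within S)"
    by (intro derivative_intros assms)
  moreover have "(1/2) *\<^sub>R (tcross (f x) (f' h) + tcross (f' h) (f x)) = tcross (f x) (f' h)" for h
    by (simp add: tcross_commute[of "f' h" "f x"] flip: scaleR_2)
  ultimately show ?thesis
    by (simp add: cof_eq_tcross)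
qed

lemma has_derivative_det3 [derivative_intros]:
  fixes f :: "'a::real_normed_vector \<Rightarrow> real^3^3"
  assumes "(f has_derivative f') (at x within S)"
  shows "((\<lambda>x. det (f x)) has_derivative (\<lambda>h. cof (f x) \<bullet> f' h)) (at x within S)"
proof -
  have "((\<lambda>x. (1/6) * (tcross (f x) (f x) \<bullet> f x)) has_derivative
      (\<lambda>h. (1/6) * (tcross (f x) (f x) \<bullet> f' h + (tcross (f x) (f' h) + tcross (f' h) (f x)) \<bullet> f x)))
      (at x within S)"
    by (intro derivative_intros assms)
  moreover have "(1/6) * (tcross (f x) (f x) \<bullet> f' h + (tcross (f x) (f' h) + tcross (f' h) (f x)) \<bullet> f x)
      = cof (f x) \<bullet> f' h" for h
    unfolding tcross_commute[of "f' h" "f x"] inner_add_left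
      inner_tcross_rotate[of "f x" "f' h" "f x"] cof_eq_tcross
    by simp
  ultimately show ?thesis
    by (simp add: det_eq_tcross)
qed

section \<open>First and second derivatives of the Mooney-Rivlin energy\<close>

lemma W_MR_has_derivative:
  assumes "det F > 0"
  shows "(W_MR has_derivative (\<lambda>K.
      - 2/3 * det F powr (-5/3) * (cof F \<bullet> K) * (F \<bullet> F) + 2 * det F powr (-2/3) * (F \<bullet> K)
      - 4/3 * det F powr (-7/3) * (cof F \<bullet> K) * (cof F \<bullet> cof F)
      + 2 * det F powr (-4/3) * (cof F \<bullet> tcross F K))) (at F)"
proof -
  \<comment> \<open>The derivative rule for \<open>powr\<close> produces a quotient by
    \<open>det F\<close>; these identities match it with the lowered exponents of the
    statement.\<close>
  have p: "det F powr - (5/3) = det F powr - (2/3) / det F" "det F powr - (7/3) = det F powr - (4/3) / det F"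
    using assms powr_diff[of "det F" "-2/3" 1] powr_diff[of "det F" "-4/3" 1] by simp_all
  show ?thesis
    unfolding W_MR_def[abs_def] frob_eq_inner
    by (rule derivative_eq_intros refl | (use assms in simp; fail))+
      (use assms in \<open>simp add: fun_eq_iff p inner_commute algebra_simps\<close>)
qed

text \<open>At \<open>det F = 1\<close> every power of the determinant is 1, which leaves a
  polynomial in the entries of \<open>F\<close>, \<open>H\<close> and \<open>K\<close>.\<close>

lemma second_derivative_W_MR:
  assumes "det F = 1"
  shows "second_derivative W_MR F H K =
      10/9 * (cof F \<bullet> H) * (cof F \<bullet> K) * (F \<bullet> F) - 2/3 * (tcross F H \<bullet> K) * (F \<bullet> F)
      - 4/3 * (cof F \<bullet> K) * (F \<bullet> H) - 4/3 * (cof F \<bullet> H) * (F \<bullet> K) + 2 * (H \<bullet> K)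
      + 28/9 * (cof F \<bullet> H) * (cof F \<bullet> K) * (cof F \<bullet> cof F)
      - 4/3 * (tcross F H \<bullet> K) * (cof F \<bullet> cof F)
      - 8/3 * (cof F \<bullet> K) * (cof F \<bullet> tcross F H) - 8/3 * (cof F \<bullet> H) * (cof F \<bullet> tcross F K)
      + 2 * (tcross F H \<bullet> tcross F K) + 2 * (cof F \<bullet> tcross H K)"
    (is "_ = ?D2 H")
proof -
  define DW where "DW G =
      - 2/3 * det G powr (-5/3) * (cof G \<bullet> K) * (G \<bullet> G) + 2 * det G powr (-2/3) * (G \<bullet> K)
      - 4/3 * det G powr (-7/3) * (cof G \<bullet> K) * (cof G \<bullet> cof G)
      + 2 * det G powr (-4/3) * (cof G \<bullet> tcross G K)" for G
  have "(det has_derivative (\<lambda>h. cof F \<bullet> h)) (at F)"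
    using has_derivative_det3[OF has_derivative_ident] by simp
  then have "(det \<longlongrightarrow> 1) (at F)"
    using has_derivative_continuous[of det] assms by (metis continuous_at)
  \<comment> \<open>The formula \<open>DW\<close> is established only where
    \<open>det G > 0\<close>. Agreement near \<open>F\<close> suffices for differentiating once
    more, and continuity of \<open>det\<close> provides it.\<close>
  then have "\<forall>\<^sub>F G in at F. det G > 0"
    by (rule order_tendstoD) simp
  moreover have DW: "DW G = frechet_derivative W_MR (at G) K" if "det G > 0" for G
    using frechet_derivative_at[OF W_MR_has_derivative[OF that]] by (simp add: DW_def fun_eq_iff)
  ultimately have ev: "\<forall>\<^sub>F G in at F. DW G = frechet_derivative W_MR (at G) K"
    by (auto elim: eventually_mono)
  have "(DW has_derivative ?D2) (at F)"
    unfolding DW_def[abs_def]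
    apply (rule derivative_eq_intros refl | (use assms in simp; fail))+
    apply (rule ext)
    subgoal for h
      by (simp add: assms inner_commute[of h F] inner_commute[of "tcross F h" "cof F"])
        (simp add: field_simps)
    done
  then have "((\<lambda>G. frechet_derivative W_MR (at G) K) has_derivative ?D2) (at F)"
    by (rule has_derivative_transform_eventually[OF _ ev]) (simp_all add: DW assms)
  then show ?thesis
    unfolding second_derivative_def by (rule frechet_derivative_at[THEN fun_cong, symmetric])
qed

section \<open>Positivity of the stability form\<close>

lemma binary_form_pos:
  fixes a b c x y :: real
  assumes "a > 0" "b^2 < 4 * a * c" "x \<noteq> 0 \<or> y \<noteq> 0"
  shows "a * x^2 + b * (x * y) + c * y^2 > 0"
proof -
  have *: "4 * a * (a * x^2 + b * (x * y) + c * y^2) = (2 * a * x + b * y)^2 + (4 * a * c - b^2) * y^2"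
    by (simp add: power2_eq_square algebra_simps)
  have "(2 * a * x + b * y)^2 + (4 * a * c - b^2) * y^2 > 0"
  proof (cases "y = 0")
    case True
    with assms show ?thesis by simp
  next
    case False
    with assms show ?thesis by (intro add_nonneg_pos mult_pos_pos) auto
  qed
  with \<open>a > 0\<close> show ?thesis
    unfolding *[symmetric] by (simp add: zero_less_mult_iff)
qed

lemma power_bounds:
  fixes s :: real
  assumes "\<bar>s\<bar> \<le> 1/4"
  shows "s^2 \<le> 1/16" "\<bar>s^3\<bar> \<le> 1/64" "s^4 \<le> 1/256"
  using power_mono[OF assms, of 2] power_mono[OF assms, of 3] power_mono[OF assms, of 4]
  by (simp_all add: power_abs power_divide)

text \<open>The block of the stability form on the half-sums of the out-of-plane entries. The
  half-differences give the same block with \<open>-s\<close>, so it is applied for both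
  signs.\<close>

lemma out_of_plane_form_pos:
  fixes s x z :: real
  assumes s: "\<bar>s\<bar> \<le> 1/4" and "x \<noteq> 0 \<or> z \<noteq> 0"
  shows "(96/5 - s) * x^2 + (24 - 16 * s + 6 * s^2) * (x * z)
      + (96/5 - 219/4 * s + 4 * s^2 - 3/2 * s^3) * z^2 > 0"
proof (rule binary_form_pos)
  have "4 * (96/5 - s) * (96/5 - 219/4 * s + 4 * s^2 - 3/2 * s^3) - (24 - 16 * s + 6 * s^2)^2
      = 22464/25 - 17568/5 * s - 89/5 * s^2 + 304/5 * s^3 - 30 * s^4"
    by (simp add: algebra_simps power2_eq_square power3_eq_cube power4_eq_xxxx)
  \<comment> \<open>The constant and linear terms leave at least 504/25, with equality at
    \<open>s = 1/4\<close>; the remaining terms cost less than 2.2.\<close>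
  also have "\<dots> > 0"
    using s power_bounds[OF s] by linarith
  finally show "(24 - 16 * s + 6 * s^2)^2 < 4 * (96/5 - s) * (96/5 - 219/4 * s + 4 * s^2 - 3/2 * s^3)"
    by simp
qed (use assms in auto)

text \<open>
  Coefficients of the binary form in \<open>p\<close> and \<open>b\<close> left over when the squares of \<open>c\<close> and then of
  \<open>a\<close> are completed in \<open>in_plane_form_pos\<close>, with the leading coefficients first lowered
  to the constants 4544/5 and 43/25.
\<close>

definition reduced_pp :: "real \<Rightarrow> real" where
  "reduced_pp s = 227/1136 - 109145393/499421952 * s^2 + 48236615/4494797568 * s^4
    - 765625/17979190272 * s^6"

definition reduced_bb :: "real \<Rightarrow> real" where
  "reduced_bb s = 208651/220160 + 63957293/56272896 * s^2 - 13238228347/95889014784 * s^4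
    + 199333855/143833522176 * s^6 - 765625/287667044352 * s^8"

definition reduced_pb :: "real \<Rightarrow> real" where
  "reduced_pb s = - 2326613/781568 * s + 1923545401/5993063424 * s^3 - 295807085/35958380544 * s^5
    + 765625/35958380544 * s^7"

text \<open>In \<open>t = s^2\<close> the diagonal coefficients are nearly linear, and the mixed one
  is \<open>s\<close> times a nearly constant \<open>g\<close>. Linear lower bounds and a constant
  bound on \<open>g\<close> reduce the discriminant condition to a quadratic inequality in
  \<open>t\<close> on [0, 1/16].\<close>

lemma reduced_form_pos:
  fixes s p b :: real
  assumes s: "\<bar>s\<bar> \<le> 1/4" and "p \<noteq> 0 \<or> b \<noteq> 0"
  shows "reduced_pp s * p^2 + reduced_pb s * (p * b) + reduced_bb s * b^2 > 0"
proof (rule binary_form_pos)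
  define t where "t = s^2"
  have t: "0 \<le> t" "t \<le> 1/16"
    using power_bounds[OF s] by (simp_all add: t_def)
  have tn: "t^2 \<le> t / 16" "t^3 \<le> t / 16" "t^4 \<le> t / 16" "0 \<le> t^2" "0 \<le> t^3" "0 \<le> t^4" "t^3 \<le> t^2"
    "t^4 \<le> t^3"
  proof -
    show "t^2 \<le> t / 16" using t mult_left_mono[of t "1/16" t] by (simp add: power2_eq_square)
    have 1: "t^3 \<le> t^2" "t^4 \<le> t^3" using t by (intro power_decreasing; simp)+
    show "t^3 \<le> t / 16" "t^4 \<le> t / 16" using 1 \<open>t^2 \<le> t / 16\<close> by linarith+
    show "t^3 \<le> t^2" "t^4 \<le> t^3" by fact+
  qed (use t in auto)
  have st: "s^2 = t" "s^4 = t^2" "s^6 = t^3" "s^8 = t^4"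
    by (simp_all add: t_def flip: power_mult)
  \<comment> \<open>In this bound and the next, the constant terms are rounded down and the slopes
    absorb the higher powers of \<open>t\<close> by means of \<open>tn\<close>.\<close>
  have a: "reduced_pp s \<ge> 1998/10000 - 2186/10000 * t"
    unfolding reduced_pp_def st using t tn by linarith
  have b: "reduced_bb s \<ge> 9477/10000 + 112/100 * t"
    unfolding reduced_bb_def st using t tn by linarith
  define g where "g = - 2326613/781568 + 1923545401/5993063424 * t - 295807085/35958380544 * t^2
    + 765625/35958380544 * t^3"
  \<comment> \<open>The absolute value is largest at \<open>t = 0\<close>, since the linear term has
    the opposite sign and outweighs the later ones; 2977/1000 rounds up 2326613/781568.\<close>
  have "\<bar>g\<bar> \<le> 2977/1000"
    unfolding g_def using t tn by (simp only: abs_le_iff) linarith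
  then have "g^2 \<le> (2977/1000)^2"
    by (subst abs_le_square_iff[symmetric]) simp
  moreover have "reduced_pb s = s * g"
    by (simp add: reduced_pb_def g_def t_def algebra_simps eval_nat_numeral)
  ultimately have "(reduced_pb s)^2 \<le> (2977/1000)^2 * t"
    using t mult_right_mono[of "g^2" "(2977/1000)^2" t]
    by (simp add: power_mult_distrib t_def mult.commute)
  also have "\<dots> < 4 * ((1998/10000 - 2186/10000 * t) * (9477/10000 + 112/100 * t))"
    using t tn by (simp add: algebra_simps power_divide flip: power2_eq_square)
  also have "\<dots> \<le> 4 * (reduced_pp s * reduced_bb s)"
    using a b t by (intro mult_left_mono mult_mono) auto
  finally show "(reduced_pb s)^2 < 4 * reduced_pp s * reduced_bb s"
    by simp
  show "reduced_pp s > 0" using a t by linarith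
qed fact

lemma complete_square:
  fixes K c l r :: real
  assumes "K > 0"
  shows "K * c^2 + l * c + r = K * (c + l / (2 * K))^2 + (r - l^2 / (4 * K))"
  using assms by (simp add: field_simps power2_eq_square)

text \<open>The Schur complement step: \<open>l\<close> and \<open>r\<close> may contain further
  variables, and positivity passes to a form in which \<open>c\<close> is eliminated.\<close>

lemma quadratic_pos:
  fixes K c l r :: real
  assumes "K > 0" "r - l^2 / (4 * K) > 0"
  shows "K * c^2 + l * c + r > 0"
  unfolding complete_square[OF assms(1)] using assms by (simp add: add_nonneg_pos)

text \<open>Two Schur complements eliminate \<open>c\<close> and then \<open>a\<close>. Constant
  pivots 4544/5 and 43/25 keep the remainders polynomial in \<open>s\<close>; the factors 5/18176
  and 25/172 are the reciprocals of four times these pivots.\<close>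

lemma in_plane_form_pos:
  fixes s p c a b :: real
  assumes s: "\<bar>s\<bar> \<le> 1/4" and nz: "p \<noteq> 0 \<or> c \<noteq> 0 \<or> a \<noteq> 0 \<or> b \<noteq> 0"
  shows "(17/16 + 67/72 * s^2) * p^2 + (4544/5 + 158/9 * s^2) * c^2 + 69/40 * a^2
      + (69/40 + 167/384 * s^2 + 47/576 * s^4) * b^2 + (56 + 28/9 * s^2) * (p * c) - 3 * s * (p * a)
      - (23/48 * s + 47/72 * s^3) * (p * b) - 10 * s * (c * a) + (67/3 * s - 7/9 * s^3) * (c * b)
      + (9/8 * s^2 - 37/16) * (a * b) > 0" (is "?T > 0")
proof -
  define P A B where "P = 56 + 28/9 * s^2" and "A = - 10 * s" and "B = 67/3 * s - 7/9 * s^3"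
  define l where "l = P * p + A * a + B * b"
  define r where "r = (17/16 + 67/72 * s^2) * p^2 + 69/40 * a^2
      + (69/40 + 167/384 * s^2 + 47/576 * s^4) * b^2 - 3 * s * (p * a)
      - (23/48 * s + 47/72 * s^3) * (p * b) + (9/8 * s^2 - 37/16) * (a * b)"
  define P' B' where "P' = 175/10224 * s^3 - 1529/568 * s"
    and "B' = 17011/13632 * s^2 - 37/16 - 175/40896 * s^4"
  define k where "k = P' * p + B' * b"
  define r' where "r' = (227/1136 + 4267/5112 * s^2 - 245/92016 * s^4) * p^2
      + (245/184032 * s^5 - 663/568 * s - 40919/61344 * s^3) * (p * b)
      + (69/40 + 48697/163584 * s^2 + 22367/245376 * s^4 - 245/1472256 * s^6) * b^2"
  have T: "?T = 158/9 * s^2 * c^2 + (4544/5 * c^2 + l * c + r)"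
    by (simp add: l_def r_def P_def A_def B_def algebra_simps)
  have l2: "l^2 = P^2 * p^2 + A^2 * a^2 + B^2 * b^2 + 2 * (P * A) * (p * a) + 2 * (P * B) * (p * b)
      + 2 * (A * B) * (a * b)"
    by (simp add: l_def power2_eq_square algebra_simps)
  have c: "17/16 + 67/72 * s^2 - 5/18176 * P^2 = 227/1136 + 4267/5112 * s^2 - 245/92016 * s^4"
    "69/40 - 5/18176 * A^2 = 69/40 - 125/4544 * s^2"
    "69/40 + 167/384 * s^2 + 47/576 * s^4 - 5/18176 * B^2
      = 69/40 + 48697/163584 * s^2 + 22367/245376 * s^4 - 245/1472256 * s^6"
    "- 3 * s - 5/18176 * (2 * (P * A)) = P'"
    "- (23/48 * s + 47/72 * s^3) - 5/18176 * (2 * (P * B))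
      = 245/184032 * s^5 - 663/568 * s - 40919/61344 * s^3"
    "9/8 * s^2 - 37/16 - 5/18176 * (2 * (A * B)) = B'"
    by (simp_all add: P_def A_def B_def P'_def B'_def algebra_simps eval_nat_numeral)
  have "r - 5/18176 * l^2 = (17/16 + 67/72 * s^2 - 5/18176 * P^2) * p^2 + (69/40 - 5/18176 * A^2) * a^2
      + (69/40 + 167/384 * s^2 + 47/576 * s^4 - 5/18176 * B^2) * b^2
      + (- 3 * s - 5/18176 * (2 * (P * A))) * (p * a)
      + (- (23/48 * s + 47/72 * s^3) - 5/18176 * (2 * (P * B))) * (p * b)
      + (9/8 * s^2 - 37/16 - 5/18176 * (2 * (A * B))) * (a * b)"
    unfolding r_def l2 by (simp add: algebra_simps)
  \<comment> \<open>The coefficient of \<open>a^2\<close> exceeds the pivot 43/25 by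
    \<open>1/200 - 125/4544 * s^2\<close>, which is nonnegative for
    \<open>s^2 \<le> 1/16\<close>.\<close>
  then have r: "r - 5/18176 * l^2 = (1/200 - 125/4544 * s^2) * a^2 + (43/25 * a^2 + k * a + r')"
    unfolding c by (simp add: k_def r'_def algebra_simps)
  have k2: "k^2 = P'^2 * p^2 + 2 * (P' * B') * (p * b) + B'^2 * b^2"
    by (simp add: k_def power2_eq_square algebra_simps)
  have c': "227/1136 + 4267/5112 * s^2 - 245/92016 * s^4 - 25/172 * P'^2 = reduced_pp s"
    "245/184032 * s^5 - 663/568 * s - 40919/61344 * s^3 - 25/172 * (2 * (P' * B')) = reduced_pb s"
    "69/40 + 48697/163584 * s^2 + 22367/245376 * s^4 - 245/1472256 * s^6 - 25/172 * B'^2 = reduced_bb s"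
    by (simp_all add: P'_def B'_def reduced_pp_def reduced_bb_def reduced_pb_def algebra_simps eval_nat_numeral)
  have "r' - 25/172 * k^2
      = (227/1136 + 4267/5112 * s^2 - 245/92016 * s^4 - 25/172 * P'^2) * p^2
      + (245/184032 * s^5 - 663/568 * s - 40919/61344 * s^3 - 25/172 * (2 * (P' * B'))) * (p * b)
      + (69/40 + 48697/163584 * s^2 + 22367/245376 * s^4 - 245/1472256 * s^6 - 25/172 * B'^2) * b^2"
    unfolding r'_def k2 by (simp add: algebra_simps)
  then have r': "r' - 25/172 * k^2 = reduced_pp s * p^2 + reduced_pb s * (p * b) + reduced_bb s * b^2"
    unfolding c' .
  have s2: "s^2 \<le> 1/16"
    using power_bounds[OF s] by simp
  then have sq: "158/9 * s^2 * c^2 \<ge> 0" "(1/200 - 125/4544 * s^2) * a^2 \<ge> 0"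
    by (auto intro!: mult_nonneg_nonneg)
  have "4544/5 * c^2 + l * c + r > 0"
  \<comment> \<open>A remainder is strictly positive only if one of its own variables is nonzero.
    Otherwise strictness comes from the eliminated variable, here and in the nested case
    split.\<close>
  proof (cases "p = 0 \<and> a = 0 \<and> b = 0")
    case True
    then show ?thesis using nz by (simp add: l_def r_def)
  next
    case False
    have "43/25 * a^2 + k * a + r' > 0"
    proof (cases "p = 0 \<and> b = 0")
      case True
      then show ?thesis using False by (simp add: k_def r'_def)
    next
      case False
      then have "r' - 25/172 * k^2 > 0"
        unfolding r' by (intro reduced_form_pos s) auto
      then show ?thesis
        by (intro quadratic_pos) auto
    qed
    then have "r - 5/18176 * l^2 > 0"
      unfolding r using sq by simp
    then show ?thesis
      by (intro quadratic_pos) auto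
  qed
  then show ?thesis
    unfolding T using sq(1) by linarith
qed

text \<open>This is the form computed in \<open>stability_form_eq\<close>. The entries with exactly
  one index 3 are never multiplied by the other five, so the two groups separate.\<close>

lemma stability_form_pos:
  fixes s h11 h12 h13 h21 h22 h23 h31 h32 h33 :: real
  assumes s: "\<bar>s\<bar> \<le> 1/4"
    and nz: "\<not> (h11 = 0 \<and> h12 = 0 \<and> h13 = 0 \<and> h21 = 0 \<and> h22 = 0 \<and> h23 = 0 \<and> h31 = 0 \<and> h32 = 0 \<and> h33 = 0)"
  shows "(11/20 + 47/144 * s^2) * (h11^2 + h22^2) + (5/18 * s^2 - 3/80) * (h11 * h22)
      + (4544/5 + 158/9 * s^2) * h33^2 + 69/40 * h12^2
      + (69/40 + 167/384 * s^2 + 47/576 * s^4) * h21^2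
      + (28 + 14/9 * s^2) * ((h11 + h22) * h33)
      - 3/2 * s * ((h11 + h22) * h12) - (23/96 * s + 47/144 * s^3) * ((h11 + h22) * h21)
      - 10 * s * (h33 * h12) + (67/3 * s - 7/9 * s^3) * (h33 * h21) + (9/8 * s^2 - 37/16) * (h12 * h21)
      + (48/5 * (h13^2 + h32^2) + (48/5 + 2 * s^2) * (h23^2 + h31^2)
        + (12 + 3 * s^2) * (h13 * h31 + h23 * h32) - 8 * s * (h13 * h23 + h31 * h32)
        - s * (h13 * h32) - (219/4 * s + 3/2 * s^3) * (h23 * h31)) > 0" (is "?Q > 0")
proof -
  \<comment> \<open>The form is invariant under exchanging \<open>h11\<close> with \<open>h22\<close>, and under exchanging
    \<open>h13\<close> with \<open>h32\<close> together with \<open>h31\<close> with \<open>h23\<close>; these coordinates diagonalize both symmetries.\<close>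
  define p m where "p = (h11 + h22) / 2" and "m = (h11 - h22) / 2"
  define x y where "x = (h13 + h32) / 2" and "y = (h13 - h32) / 2"
  define z w where "z = (h31 + h23) / 2" and "w = (h31 - h23) / 2"
  note defs = p_def m_def x_def y_def z_def w_def
  have h: "h11 = p + m" "h22 = p - m" "h13 = x + y" "h32 = x - y" "h31 = z + w" "h23 = z - w"
    by (simp_all add: defs field_simps)
  \<comment> \<open>Only the first two terms see \<open>m\<close>: every other term contains
    \<open>h11\<close> and \<open>h22\<close> through their sum, if at all.\<close>
  let ?M = "(91/80 + 3/8 * s^2) * m^2"
  let ?I = "\<lambda>p c a b. (17/16 + 67/72 * s^2) * p^2 + (4544/5 + 158/9 * s^2) * c^2 + 69/40 * a^2
      + (69/40 + 167/384 * s^2 + 47/576 * s^4) * b^2 + (56 + 28/9 * s^2) * (p * c) - 3 * s * (p * a)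
      - (23/48 * s + 47/72 * s^3) * (p * b) - 10 * s * (c * a) + (67/3 * s - 7/9 * s^3) * (c * b)
      + (9/8 * s^2 - 37/16) * (a * b)"
  let ?O = "\<lambda>s x z. (96/5 - s) * x^2 + (24 - 16 * s + 6 * s^2) * (x * z)
      + (96/5 - 219/4 * s + 4 * s^2 - 3/2 * s^3) * z^2"
  have 1: "(11/20 + 47/144 * s^2) * (h11^2 + h22^2) + (5/18 * s^2 - 3/80) * (h11 * h22)
      = ?M + (17/16 + 67/72 * s^2) * p^2"
    unfolding h by (simp add: field_simps power2_eq_square)
  have 2: "(28 + 14/9 * s^2) * ((h11 + h22) * h33) = (56 + 28/9 * s^2) * (p * h33)"
    "3/2 * s * ((h11 + h22) * h12) = 3 * s * (p * h12)"
    "(23/96 * s + 47/144 * s^3) * ((h11 + h22) * h21) = (23/48 * s + 47/72 * s^3) * (p * h21)"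
    unfolding h by (simp_all add: algebra_simps)
  have 3: "48/5 * (h13^2 + h32^2) + (48/5 + 2 * s^2) * (h23^2 + h31^2)
      + (12 + 3 * s^2) * (h13 * h31 + h23 * h32) - 8 * s * (h13 * h23 + h31 * h32)
      - s * (h13 * h32) - (219/4 * s + 3/2 * s^3) * (h23 * h31) = ?O s x z + ?O (-s) y w"
    unfolding h by (simp add: field_simps eval_nat_numeral)
  have Q: "?Q = ?M + ?I p h33 h12 h21 + ?O s x z + ?O (-s) y w"
    unfolding 1 2 3 by (simp only: diff_conv_add_uminus add.assoc)
  have pos: "a + b + c + d > 0"
    if "a \<ge> 0" "b \<ge> 0" "c \<ge> 0" "d \<ge> 0" "a > 0 \<or> b > 0 \<or> c > 0 \<or> d > 0" for a b c d :: real
    using that by linarith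
  have M: "?M \<ge> 0" "m \<noteq> 0 \<Longrightarrow> ?M > 0"
    by (auto intro!: mult_nonneg_nonneg mult_pos_pos add_pos_nonneg)
  have I: "?I p h33 h12 h21 \<ge> 0" "p \<noteq> 0 \<or> h33 \<noteq> 0 \<or> h12 \<noteq> 0 \<or> h21 \<noteq> 0 \<Longrightarrow> ?I p h33 h12 h21 > 0"
    using in_plane_form_pos[OF s, of p h33 h12 h21]
    by (cases "p \<noteq> 0 \<or> h33 \<noteq> 0 \<or> h12 \<noteq> 0 \<or> h21 \<noteq> 0"; force)+
  have O: "?O s x z \<ge> 0" "x \<noteq> 0 \<or> z \<noteq> 0 \<Longrightarrow> ?O s x z > 0" if "\<bar>s\<bar> \<le> 1/4" for s x z :: real
    using out_of_plane_form_pos[OF that, of x z] by (cases "x \<noteq> 0 \<or> z \<noteq> 0"; force)+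
  have s': "\<bar>-s\<bar> \<le> 1/4" using s by simp
  have "m \<noteq> 0 \<or> (p \<noteq> 0 \<or> h33 \<noteq> 0 \<or> h12 \<noteq> 0 \<or> h21 \<noteq> 0) \<or> (x \<noteq> 0 \<or> z \<noteq> 0) \<or> (y \<noteq> 0 \<or> w \<noteq> 0)"
    using nz unfolding h by auto
  then have "?M > 0 \<or> ?I p h33 h12 h21 > 0 \<or> ?O s x z > 0 \<or> ?O (-s) y w > 0"
    using M(2) I(2) O(2)[OF s, of x z] O(2)[OF s', of y w] by blast
  then show ?thesis
    unfolding Q by (intro pos M(1) I(1) O(1) s s')
qed

section \<open>Evaluation of both sides of the inequality in matrix entries\<close>

lemma diag3_nth [simp]:
  "diag3 a b c $ 1 $ 1 = a" "diag3 a b c $ 1 $ 2 = 0" "diag3 a b c $ 1 $ 3 = 0"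
  "diag3 a b c $ 2 $ 1 = 0" "diag3 a b c $ 2 $ 2 = b" "diag3 a b c $ 2 $ 3 = 0"
  "diag3 a b c $ 3 $ 1 = 0" "diag3 a b c $ 3 $ 2 = 0" "diag3 a b c $ 3 $ 3 = c"
  by (simp_all add: diag3_def)

lemma inner_matrix3:
  "A \<bullet> B = A$1$1 * B$1$1 + A$1$2 * B$1$2 + A$1$3 * B$1$3
    + A$2$1 * B$2$1 + A$2$2 * B$2$2 + A$2$3 * B$2$3
    + A$3$1 * B$3$1 + A$3$2 * B$3$2 + A$3$3 * B$3$3" for A B :: "real^3^3"
  by (simp add: inner_vec_def sum_3)

lemma matrix_inv_eqI:
  fixes A B :: "'a::semiring_1^'n^'n"
  assumes "A ** B = mat 1" "B ** A = mat 1"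
  shows "matrix_inv A = B"
  unfolding matrix_inv_def
proof (rule some_equality)
  fix B' assume B': "A ** B' = mat 1 \<and> B' ** A = mat 1"
  have "B' = B' ** (A ** B)"
    by (simp add: assms)
  also have "\<dots> = B"
    by (simp add: matrix_mul_assoc B')
  finally show "B' = B" .
qed (use assms in auto)

lemma matrix_inv_diag3:
  assumes "a \<noteq> 0" "b \<noteq> 0" "c \<noteq> 0"
  shows "matrix_inv (transpose (diag3 a b c)) = diag3 (1/a) (1/b) (1/c)"
  using assms
  by (intro matrix_inv_eqI)
    (auto simp: vec_eq_iff forall_3 matrix_matrix_mult_def sum_3 mat_def transpose_def)

lemma theta_diag3:
  assumes "a \<noteq> 0" "b \<noteq> 0" "c \<noteq> 0"
  shows "theta (diag3 a b c) H = H$1$1 / a + H$2$2 / b + H$3$3 / c"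
  using assms by (simp add: theta_def frob_eq_inner matrix_inv_diag3 inner_matrix3)

text \<open>The scalar ingredients of the second derivative are evaluated one by one, so that a
  single polynomial identity in \<open>s\<close> and the entries of \<open>H\<close> remains. The
  comparison term is taken at \<open>s = 0\<close> and contributes no power of
  \<open>s\<close>.\<close>

lemma stability_form_eq:
  fixes s :: real and H :: "real^3^3"
  defines "F \<equiv> diag3 2 2 (1/4) + s *\<^sub>R outer (axis 1 1) (axis 2 1)"
  shows "second_derivative W_MR F H H + frob (diag3 (191/4) (191/4) 0) (tcross H H)
      - 1/5 * A1 (diag3 2 2 (1/4)) H H =
      (11/20 + 47/144 * s^2) * ((H$1$1)^2 + (H$2$2)^2) + (5/18 * s^2 - 3/80) * (H$1$1 * H$2$2)
      + (4544/5 + 158/9 * s^2) * (H$3$3)^2 + 69/40 * (H$1$2)^2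
      + (69/40 + 167/384 * s^2 + 47/576 * s^4) * (H$2$1)^2
      + (28 + 14/9 * s^2) * ((H$1$1 + H$2$2) * H$3$3)
      - 3/2 * s * ((H$1$1 + H$2$2) * H$1$2) - (23/96 * s + 47/144 * s^3) * ((H$1$1 + H$2$2) * H$2$1)
      - 10 * s * (H$3$3 * H$1$2) + (67/3 * s - 7/9 * s^3) * (H$3$3 * H$2$1)
      + (9/8 * s^2 - 37/16) * (H$1$2 * H$2$1)
      + (48/5 * ((H$1$3)^2 + (H$3$2)^2) + (48/5 + 2 * s^2) * ((H$2$3)^2 + (H$3$1)^2)
        + (12 + 3 * s^2) * (H$1$3 * H$3$1 + H$2$3 * H$3$2) - 8 * s * (H$1$3 * H$2$3 + H$3$1 * H$3$2)
        - s * (H$1$3 * H$3$2) - (219/4 * s + 3/2 * s^3) * (H$2$3 * H$3$1))"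
proof -
  have F: "F$1$1 = 2" "F$1$2 = s" "F$1$3 = 0" "F$2$1 = 0" "F$2$2 = 2" "F$2$3 = 0"
    "F$3$1 = 0" "F$3$2 = 0" "F$3$3 = 1/4"
    by (simp_all add: F_def outer_def axis_def)
  have C: "cof F = vector [vector [1/2, 0, 0], vector [-s/4, 1/2, 0], vector [0, 0, 4]]"
    by (simp add: cof_def F)
  have det: "det F = 1" "det (diag3 2 2 (1/4)) = 1"
    by (simp_all add: det_3 F)
  have CK: "cof F \<bullet> K = (K$1$1 + K$2$2) / 2 - s / 4 * K$2$1 + 4 * K$3$3" for K
    by (simp add: C inner_matrix3 field_simps)
  have FK: "F \<bullet> K = 2 * (K$1$1 + K$2$2) + s * K$1$2 + K$3$3 / 4" for K
    by (simp add: F inner_matrix3 field_simps)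
  define h11 h12 h13 h21 h22 h23 h31 h32 h33 where h: "h11 = H$1$1" "h12 = H$1$2" "h13 = H$1$3"
    "h21 = H$2$1" "h22 = H$2$2" "h23 = H$2$3" "h31 = H$3$1" "h32 = H$3$2" "h33 = H$3$3"
  note h' = h[symmetric]
  have th: "theta (diag3 2 2 (1/4)) H = (h11 + h22) / 2 + 4 * h33"
    by (simp add: theta_diag3 h' field_simps)
  have HH: "H \<bullet> H = h11^2 + h12^2 + h13^2 + h21^2 + h22^2 + h23^2 + h31^2 + h32^2 + h33^2"
    by (simp add: inner_matrix3 h' power2_eq_square)
  have DD: "diag3 2 2 (1/4) \<bullet> diag3 2 2 (1/4) = 129/16"
    and DH: "diag3 2 2 (1/4) \<bullet> H = 2 * (h11 + h22) + h33 / 4"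
    by (simp_all add: inner_matrix3 h' field_simps)
  \<comment> \<open>The factor 5/9 collects 4/9 from the expanded square and 1/9 from the separate
    \<open>theta\<close> term of \<open>A1\<close>.\<close>
  have "A1 (diag3 2 2 (1/4)) H H = 2 * (H \<bullet> H
      - 4/3 * theta (diag3 2 2 (1/4)) H * (diag3 2 2 (1/4) \<bullet> H)
      + 5/9 * (diag3 2 2 (1/4) \<bullet> diag3 2 2 (1/4)) * (theta (diag3 2 2 (1/4)) H)^2)"
    by (simp add: A1_def det frob_eq_inner inner_diff inner_commute[of H "diag3 _ _ _"]
        power2_eq_square field_simps)
  then have A: "A1 (diag3 2 2 (1/4)) H H = 2 * (H \<bullet> H)
      - 8/3 * ((h11 + h22) / 2 + 4 * h33) * (2 * (h11 + h22) + h33 / 4)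
      + 215/24 * ((h11 + h22) / 2 + 4 * h33)^2"
    unfolding th DD DH by simp
  have CC: "cof F \<bullet> cof F = 33/2 + s^2 / 16" and FF: "F \<bullet> F = 129/16 + s^2"
    by (simp_all add: C F inner_matrix3 field_simps power2_eq_square)
  have CH: "cof F \<bullet> H = (h11 + h22) / 2 - s / 4 * h21 + 4 * h33"
    and FH: "F \<bullet> H = 2 * (h11 + h22) + s * h12 + h33 / 4"
    by (simp_all add: CK FK h')
  have T: "tcross F H = vector [
     vector [2 * h33 + h22 / 4, - h21 / 4, - 2 * h31],
     vector [- s * h33 - h12 / 4, 2 * h33 + h11 / 4, s * h31 - 2 * h32],
     vector [s * h23 - 2 * h13, - 2 * h23, 2 * h22 + 2 * h11 - s * h21]]"
    by (simp add: tcross_entries F h' vec_eq_iff forall_3)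
  have TH: "tcross F H \<bullet> H = 4 * ((h11 + h22) * h33 - h13 * h31 - h23 * h32) + (h11 * h22 - h12 * h21) / 2
      - 2 * s * (h21 * h33 - h23 * h31)"
    by (simp add: T inner_matrix3 h' field_simps)
  have CT: "cof F \<bullet> tcross F H = 2 * h33 + (h11 + h22) / 8 + s^2 / 4 * h33 + s / 16 * h12
      + 8 * (h11 + h22) - 4 * s * h21"
    by (simp add: CK T field_simps power2_eq_square)
  have TT: "tcross F H \<bullet> tcross F H = (2 * h33 + h22 / 4)^2 + h21^2 / 16 + 4 * h31^2
     + (s * h33 + h12 / 4)^2 + (2 * h33 + h11 / 4)^2 + (s * h31 - 2 * h32)^2
     + (s * h23 - 2 * h13)^2 + 4 * h23^2 + (2 * (h11 + h22) - s * h21)^2"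
    by (simp add: T inner_matrix3 power2_eq_square algebra_simps)
  have CTH: "cof F \<bullet> tcross H H = h22 * h33 - h23 * h32 + h11 * h33 - h13 * h31
      - s / 2 * (h13 * h32 - h12 * h33) + 8 * (h11 * h22 - h12 * h21)"
    by (simp add: CK tcross_entries h' field_simps)
  \<comment> \<open>This explains the size of 191/4: at \<open>s = 0\<close> the products
    \<open>h13 * h31\<close> and \<open>h23 * h32\<close> would otherwise have coefficient 215/2,
    against squares with coefficient 48/5. Subtracting 191/2 leaves 12, which is below 2 *
    48/5.\<close>
  have Z: "frob (diag3 (191/4) (191/4) 0) (tcross H H)
      = 191/2 * (h22 * h33 - h23 * h32 + h11 * h33 - h13 * h31)"
    by (simp add: frob_eq_inner inner_matrix3 tcross_entries h' field_simps)
  show ?thesis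
    unfolding second_derivative_W_MR[OF det(1)] A CC FF CH FH TH CT TT CTH Z HH h'
    apply (simp add: algebra_simps eval_nat_numeral add_divide_distrib diff_divide_distrib)
    done
qed

section \<open>The quadrature rule and alignment\<close>

definition vec3_of :: "real \<times> real \<times> real \<Rightarrow> real^3" where
  "vec3_of = (\<lambda>(x, y, z). vector [x, y, z])"

lemma vec3_of_nth [simp]: "vec3_of (x, y, z) $ 1 = x" "vec3_of (x, y, z) $ 2 = y" "vec3_of (x, y, z) $ 3 = z"
  by (simp_all add: vec3_of_def)

lemma bounded_linear_vec3_of: "bounded_linear vec3_of"
  unfolding linear_conv_bounded_linear[symmetric]
  by (auto intro!: linearI simp: vec_eq_iff forall_3)

lemma continuous_on_vec3_of [continuous_intros]:
  "continuous_on S f \<Longrightarrow> continuous_on S (\<lambda>x. vec3_of (f x))"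
  using bounded_linear.continuous_on[OF bounded_linear_vec3_of] .

text \<open>Lebesgue measure is determined by its values on boxes, and boxes pull back to products
  of intervals. This makes Fubini's theorem for pairs available on \<open>real^3\<close>.\<close>

lemma lborel_vec3: "lborel = distr (lborel \<Otimes>\<^sub>M (lborel \<Otimes>\<^sub>M lborel)) borel vec3_of"
proof (rule lborel_eqI)
  fix l u :: "real^3"
  assume le: "\<And>b. b \<in> Basis \<Longrightarrow> l \<bullet> b \<le> u \<bullet> b"
  have nth: "l $ i \<le> u $ i" for i
    using le[of "axis i 1"] by (simp add: inner_axis axis_in_Basis_iff)
  have B: "(Basis :: (real^3) set) = {axis 1 1, axis 2 1, axis 3 1}"
    by (auto simp: Basis_vec_def) (metis exhaust_3)
  have "vec3_of -` box l u = {l$1<..<u$1} \<times> {l$2<..<u$2} \<times> {l$3<..<u$3}"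
    by (auto simp: mem_box_cart forall_3)
  moreover have "vec3_of \<in> lborel \<Otimes>\<^sub>M (lborel \<Otimes>\<^sub>M lborel) \<rightarrow>\<^sub>M borel"
    unfolding lborel_prod
    by (simp add: borel_measurable_continuous_onI continuous_on_vec3_of)
  moreover have "emeasure (lborel \<Otimes>\<^sub>M (lborel \<Otimes>\<^sub>M lborel)) (A \<times> B \<times> C)
      = emeasure lborel A * (emeasure lborel B * emeasure lborel C)"
    if "A \<in> sets borel" "B \<in> sets borel" "C \<in> sets borel" for A B C :: "real set"
  proof -
    have "sigma_finite_measure (lborel \<Otimes>\<^sub>M lborel :: (real \<times> real) measure)"
      unfolding lborel_prod by (rule sigma_finite_lborel)
    then show ?thesis
      using that by (simp add: sigma_finite_measure.emeasure_pair_measure_Times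
          lborel.emeasure_pair_measure_Times)
  qed
  ultimately show "emeasure (distr (lborel \<Otimes>\<^sub>M (lborel \<Otimes>\<^sub>M lborel)) borel vec3_of) (box l u)
      = (\<Prod>b\<in>Basis. (u - l) \<bullet> b)"
    using nth by (simp add: emeasure_distr space_pair_measure B axis_eq_axis inner_axis ennreal_mult)
qed simp

lemma ref_tet_eq: "ref_tet = {\<xi>. 0 \<le> \<xi>$1 \<and> 0 \<le> \<xi>$2 \<and> 0 \<le> \<xi>$3 \<and> \<xi>$1 + \<xi>$2 + \<xi>$3 \<le> 1}"
  by (simp add: ref_tet_def forall_3 sum_3)

lemma compact_ref_tet: "compact ref_tet"
unfolding compact_eq_bounded_closed
proof
  show "closed ref_tet"
    unfolding ref_tet_eq
    by (intro closed_Collect_conj closed_Collect_le continuous_intros)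
  have "norm \<xi> \<le> 3" if "\<xi> \<in> ref_tet" for \<xi>
    using norm_le_l1_cart[of \<xi>] that by (simp add: ref_tet_eq sum_3)
  then show "bounded ref_tet"
    by (auto simp: bounded_iff)
qed

text \<open>Degree four suffices: each of the two inner integrations of a quadratic over the
  tetrahedron raises the degree by one.\<close>

lemma integral_quartic:
  fixes d e0 e1 e2 e3 e4 :: real
  assumes "0 \<le> d"
  shows "(\<integral>y. (e0 + e1 * y + e2 * y^2 + e3 * y^3 + e4 * y^4) * indicator {0..d} y \<partial>lborel)
    = e0 * d + e1 * d^2 / 2 + e2 * d^3 / 3 + e3 * d^4 / 4 + e4 * d^5 / 5"
proof -
  let ?F = "\<lambda>y. e0 * y + e1 * y^2 / 2 + e2 * y^3 / 3 + e3 * y^4 / 4 + e4 * y^5 / 5"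
  have "(\<integral>y. (e0 + e1 * y + e2 * y^2 + e3 * y^3 + e4 * y^4) * indicator {0..d} y \<partial>lborel) = ?F d - ?F 0"
    by (rule integral_FTC_Icc_real[OF assms])
      (auto intro!: derivative_eq_intros continuous_intros simp: field_simps)
  then show ?thesis by simp
qed

lemma integral_ref_tet_iterated:
  fixes f :: "real^3 \<Rightarrow> real"
  assumes f: "continuous_on UNIV f"
  shows "integral ref_tet f = (\<integral>x. (\<integral>y. (\<integral>z. f (vec3_of (x, y, z)) * indicator {0..1 - x - y} z \<partial>lborel)
    * indicator {0..1 - x} y \<partial>lborel) * indicator {0..1} x \<partial>lborel)"
proof -
  have mv: "vec3_of \<in> lborel \<Otimes>\<^sub>M (lborel \<Otimes>\<^sub>M lborel) \<rightarrow>\<^sub>M borel"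
    unfolding lborel_prod
    by (simp add: borel_measurable_continuous_onI continuous_on_vec3_of)
  define g where "g w = f (vec3_of w) * indicator ref_tet (vec3_of w)" for w
  have int: "integrable lborel (\<lambda>\<xi>. indicator ref_tet \<xi> *\<^sub>R f \<xi>)"
    by (intro borel_integrable_compact compact_ref_tet continuous_on_subset[OF f]) simp
  \<comment> \<open>The indicator factors with nested limits because \<open>y \<le> 1 - x\<close>
    and \<open>x \<le> 1\<close> follow from the nonnegativity of the inner coordinates.\<close>
  have g3: "g (x, y, z) = f (vec3_of (x, y, z)) * indicator {0..1 - x - y} z * indicator {0..1 - x} y
      * indicator {0..1} x" for x y z
    by (auto simp: g_def ref_tet_eq indicator_def)
  have "integral ref_tet f = (\<integral>\<xi>. indicator ref_tet \<xi> *\<^sub>R f \<xi> \<partial>lborel)"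
    using int by (subst set_borel_integral_eq_integral(2)[symmetric])
      (simp_all add: set_integrable_def set_lebesgue_integral_def)
  also have "\<dots> = integral\<^sup>L (lborel \<Otimes>\<^sub>M (lborel \<Otimes>\<^sub>M lborel)) g"
    using borel_measurable_integrable[OF int]
    by (subst lborel_vec3, subst integral_distr[OF mv]) (simp_all add: g_def[abs_def] mult.commute)
  also have "\<dots> = (\<integral>x. (\<integral>w. g (x, w) \<partial>(lborel \<Otimes>\<^sub>M lborel)) \<partial>lborel)"
  proof -
    have "integrable (lborel \<Otimes>\<^sub>M (lborel \<Otimes>\<^sub>M lborel)) g"
      using int borel_measurable_integrable[OF int] unfolding lborel_vec3
      by (subst (asm) integrable_distr_eq[OF mv]) (simp_all add: g_def[abs_def] mult.commute)
    then show ?thesis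
      unfolding lborel_prod by (rule lborel_pair.integral_fst'[unfolded lborel_prod, symmetric])
  qed
  also have "\<dots> = (\<integral>x. (\<integral>y. (\<integral>z. g (x, y, z) \<partial>lborel) \<partial>lborel) \<partial>lborel)"
  proof (rule Bochner_Integration.integral_cong)
    fix x :: real
    \<comment> \<open>Each slice at fixed \<open>x\<close> is compact, so the second use of Fubini
      is justified for every \<open>x\<close>.\<close>
    let ?S = "{w. vec3_of (x, w) \<in> ref_tet}"
    have "closed ?S"
      using closed_vimage[OF compact_imp_closed[OF compact_ref_tet], of "\<lambda>w. vec3_of (x, w)"]
      by (simp add: vimage_def continuous_intros)
    moreover have "?S \<subseteq> {0..1} \<times> {0..1}"
      by (auto simp: ref_tet_eq)
    then have "bounded ?S"
      by (rule bounded_subset[rotated]) (simp add: bounded_Times)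
    ultimately have "compact ?S"
      by (simp add: compact_eq_bounded_closed)
    then have "integrable lborel (\<lambda>w. indicator ?S w *\<^sub>R f (vec3_of (x, w)))"
      by (intro borel_integrable_compact continuous_on_compose2[OF f] continuous_intros) auto
    then have "integrable (lborel \<Otimes>\<^sub>M lborel) (\<lambda>w. g (x, w))"
      unfolding lborel_prod by (simp add: g_def indicator_def mult.commute)
    then show "(\<integral>w. g (x, w) \<partial>(lborel \<Otimes>\<^sub>M lborel)) = (\<integral>y. (\<integral>z. g (x, y, z) \<partial>lborel) \<partial>lborel)"
      by (rule lborel_pair.integral_fst'[symmetric])
  qed simp
  finally show ?thesis
    unfolding g3 by simp
qed


text \<open>The weights are the moments i! j! k! / (i + j + k + 3)! of the monomials with exponents
  i, j, k.\<close>

lemma integral_ref_tet_quadratic: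
  fixes a b1 b2 b3 c11 c22 c33 d12 d13 d23 :: real
  shows "integral ref_tet (\<lambda>\<xi>. a + b1 * \<xi>$1 + b2 * \<xi>$2 + b3 * \<xi>$3
      + c11 * (\<xi>$1)^2 + c22 * (\<xi>$2)^2 + c33 * (\<xi>$3)^2
      + d12 * (\<xi>$1 * \<xi>$2) + d13 * (\<xi>$1 * \<xi>$3) + d23 * (\<xi>$2 * \<xi>$3))
    = a / 6 + (b1 + b2 + b3) / 24 + (c11 + c22 + c33) / 60 + (d12 + d13 + d23) / 120"
    (is "integral ref_tet ?f = ?I")
proof -
  have 1: "(\<integral>z. ?f (vec3_of (x, y, z)) * indicator {0..1 - x - y} z \<partial>lborel)
      = (a + b1 * x + b2 * y + c11 * x^2 + c22 * y^2 + d12 * (x * y)) * (1 - x - y)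
        + (b3 + d13 * x + d23 * y) * (1 - x - y)^2 / 2 + c33 * (1 - x - y)^3 / 3"
    if "y \<le> 1 - x" for x y
    using integral_quartic[of "1 - x - y" "a + b1 * x + b2 * y + c11 * x^2 + c22 * y^2 + d12 * (x * y)"
        "b3 + d13 * x + d23 * y" c33 0 0] that
    by (simp add: algebra_simps)
  have 2: "(\<integral>y. (\<integral>z. ?f (vec3_of (x, y, z)) * indicator {0..1 - x - y} z \<partial>lborel)
        * indicator {0..1 - x} y \<partial>lborel)
      = (a + b1 * x + c11 * x^2) * (1 - x)^2 / 2 + (b2 + b3 + (d12 + d13) * x) * (1 - x)^3 / 6
        + (c22 / 12 + d23 / 24 + c33 / 12) * (1 - x)^4"
    if "x \<le> 1" for x
  proof -
    define d A0 A1 B0 where "d = 1 - x" and "A0 = a + b1 * x + c11 * x^2" and "A1 = b2 + d12 * x"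
      and "B0 = b3 + d13 * x"
    have d: "0 \<le> d"
      using that by (simp add: d_def)
    have "(\<integral>y. (\<integral>z. ?f (vec3_of (x, y, z)) * indicator {0..1 - x - y} z \<partial>lborel)
        * indicator {0..1 - x} y \<partial>lborel)
      = (\<integral>y. ((A0 * d + B0 * d^2 / 2 + c33 * d^3 / 3)
          + (A1 * d - A0 - B0 * d + d23 * d^2 / 2 - c33 * d^2) * y
          + (c22 * d - A1 + B0 / 2 - d23 * d + c33 * d) * y^2 + (d23 / 2 - c22 - c33 / 3) * y^3 + 0 * y^4)
        * indicator {0..d} y \<partial>lborel)"
    proof (rule Bochner_Integration.integral_cong)
      fix y :: real
      have "(A0 + A1 * y + c22 * y^2) * (d - y) + (B0 + d23 * y) * (d - y)^2 / 2 + c33 * (d - y)^3 / 3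
        = (A0 * d + B0 * d^2 / 2 + c33 * d^3 / 3)
          + (A1 * d - A0 - B0 * d + d23 * d^2 / 2 - c33 * d^2) * y
          + (c22 * d - A1 + B0 / 2 - d23 * d + c33 * d) * y^2 + (d23 / 2 - c22 - c33 / 3) * y^3 + 0 * y^4"
        by (simp add: field_simps power2_eq_square power3_eq_cube)
      moreover have "(a + b1 * x + b2 * y + c11 * x^2 + c22 * y^2 + d12 * (x * y)) * (1 - x - y)
        + (b3 + d13 * x + d23 * y) * (1 - x - y)^2 / 2 + c33 * (1 - x - y)^3 / 3
        = (A0 + A1 * y + c22 * y^2) * (d - y) + (B0 + d23 * y) * (d - y)^2 / 2 + c33 * (d - y)^3 / 3"
        by (simp add: A0_def A1_def B0_def d_def algebra_simps)
      \<comment> \<open>Formula \<open>1\<close> requires \<open>y \<le> 1 - x\<close>; beyond that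
        limit the indicator annihilates both sides.\<close>
      ultimately show "(\<integral>z. ?f (vec3_of (x, y, z)) * indicator {0..1 - x - y} z \<partial>lborel) * indicator {0..1 - x} y
        = ((A0 * d + B0 * d^2 / 2 + c33 * d^3 / 3)
          + (A1 * d - A0 - B0 * d + d23 * d^2 / 2 - c33 * d^2) * y
          + (c22 * d - A1 + B0 / 2 - d23 * d + c33 * d) * y^2 + (d23 / 2 - c22 - c33 / 3) * y^3 + 0 * y^4)
        * indicator {0..d} y"
        using 1[of y x] by (cases "y \<in> {0..1 - x}") (simp_all add: d_def)
    qed simp
    also have "\<dots> = A0 * d^2 / 2 + (A1 + B0) * d^3 / 6 + (c22 / 12 + d23 / 24 + c33 / 12) * d^4"
      using d by (subst integral_quartic) (simp_all add: field_simps eval_nat_numeral)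
    finally show ?thesis
      by (simp add: A0_def A1_def B0_def d_def algebra_simps)
  qed
  define e f k where "e = b2 + b3" and "f = d12 + d13" and "k = c22 / 12 + d23 / 24 + c33 / 12"
  have "integral ref_tet ?f = (\<integral>x. ((a/2 + e/6 + k) + (- a + b1/2 - e/2 + f/6 - 4 * k) * x
      + (a/2 - b1 + c11/2 + e/2 - f/2 + 6 * k) * x^2 + (b1/2 - c11 - e/6 + f/2 - 4 * k) * x^3
      + (c11/2 - f/6 + k) * x^4) * indicator {0..1} x \<partial>lborel)"
  proof (subst integral_ref_tet_iterated, intro continuous_intros, rule Bochner_Integration.integral_cong)
    fix x :: real
    have "(a + b1 * x + c11 * x^2) * (1 - x)^2 / 2 + (e + f * x) * (1 - x)^3 / 6 + k * (1 - x)^4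
      = (a/2 + e/6 + k) + (- a + b1/2 - e/2 + f/6 - 4 * k) * x
      + (a/2 - b1 + c11/2 + e/2 - f/2 + 6 * k) * x^2 + (b1/2 - c11 - e/6 + f/2 - 4 * k) * x^3
      + (c11/2 - f/6 + k) * x^4"
      by (simp add: field_simps eval_nat_numeral)
    then show "(\<integral>y. (\<integral>z. ?f (vec3_of (x, y, z)) * indicator {0..1 - x - y} z \<partial>lborel)
        * indicator {0..1 - x} y \<partial>lborel) * indicator {0..1} x = ((a/2 + e/6 + k)
      + (- a + b1/2 - e/2 + f/6 - 4 * k) * x
      + (a/2 - b1 + c11/2 + e/2 - f/2 + 6 * k) * x^2 + (b1/2 - c11 - e/6 + f/2 - 4 * k) * x^3
      + (c11/2 - f/6 + k) * x^4) * indicator {0..1} x"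
      using 2[of x] by (cases "x \<in> {0..1}") (simp_all add: e_def f_def k_def)
  qed simp
  also have "\<dots> = ?I"
    by (subst integral_quartic) (simp_all add: e_def f_def k_def field_simps)
  finally show ?thesis .
qed

section \<open>Exactness of the four-point rule on quadratic polynomials\<close>

lemma zero_neq_axis: "0 \<noteq> (axis i 1 :: real^3)"
  by (metis axis_eq_0_iff zero_neq_one)

lemma sum_tet_vertices: "(\<Sum>v\<in>tet_vertices. f v) = f 0 + (f (axis 1 1) + (f (axis 2 1) + f (axis 3 1)))"
proof -
  have *: "tet_vertices = {0, axis 1 1, axis 2 1, axis 3 1}"
    by (auto simp: tet_vertices_def) (metis exhaust_3)
  show ?thesis
    unfolding * by (simp add: axis_eq_axis zero_neq_axis)
qed

text \<open>A name for the witnesses of \<open>poly2\<close>. Since \<open>c\<close> need not be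
  symmetric, only the sums \<open>c i j + c j i\<close> are determined by the function.\<close>

definition quad_fun :: "real \<Rightarrow> (3 \<Rightarrow> real) \<Rightarrow> (3 \<Rightarrow> 3 \<Rightarrow> real) \<Rightarrow> real^3 \<Rightarrow> real" where
  "quad_fun a b c \<xi> = a + (\<Sum>i\<in>UNIV. b i * \<xi> $ i) + (\<Sum>i\<in>UNIV. \<Sum>j\<in>UNIV. c i j * \<xi> $ i * \<xi> $ j)"

lemma poly2_iff: "p \<in> poly2 \<longleftrightarrow> (\<exists>a b c. p = quad_fun a b c)"
  by (auto simp: poly2_def quad_fun_def fun_eq_iff)

text \<open>The nodes satisfy \<alpha> + 3 \<beta> = 1, and \<beta> is a root of a rational
  quadratic. Hence \<alpha>^2 + 3 \<beta>^2 = 2/5 and 2 \<alpha> \<beta> + 2 \<beta>^2 = 1/5, which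
  after weighting by 1/24 are the exact second moments 1/60 and 1/120.\<close>

lemma Q4_quad_fun:
  "Q4 (quad_fun a b c) = a / 6 + (b 1 + b 2 + b 3) / 24 + (c 1 1 + c 2 2 + c 3 3) / 60
    + (c 1 2 + c 2 1 + c 1 3 + c 3 1 + c 2 3 + c 3 2) / 120"
proof -
  define \<alpha> \<beta> :: real where "\<alpha> = (5 + 3 * sqrt 5) / 20" and "\<beta> = (5 - sqrt 5) / 20"
  have \<alpha>: "\<alpha> = 1 - 3 * \<beta>" and \<beta>2: "\<beta> * \<beta> = \<beta> / 2 - 1/20"
    by (simp_all add: \<alpha>_def \<beta>_def field_simps)
  have \<beta>2': "\<beta> * (\<beta> * x) = (\<beta> / 2 - 1/20) * x" for x
    by (simp flip: \<beta>2)
  show ?thesis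
    unfolding Q4_def sum_tet_vertices \<alpha>_def[symmetric] \<beta>_def[symmetric]
    by (simp add: axis_eq_axis zero_neq_axis zero_neq_axis[symmetric])
      (simp add: quad_fun_def sum_3 axis_def \<alpha> \<beta>2 \<beta>2' algebra_simps add_divide_distrib diff_divide_distrib)
qed

lemma Q4_exact_poly2:
  assumes "p \<in> poly2"
  shows "Q4 p = integral ref_tet p"
proof -
  obtain a b c where p: "p = quad_fun a b c"
    using assms poly2_iff by auto
  have "quad_fun a b c = (\<lambda>\<xi>. a + b 1 * \<xi>$1 + b 2 * \<xi>$2 + b 3 * \<xi>$3
      + c 1 1 * (\<xi>$1)^2 + c 2 2 * (\<xi>$2)^2 + c 3 3 * (\<xi>$3)^2
      + (c 1 2 + c 2 1) * (\<xi>$1 * \<xi>$2) + (c 1 3 + c 3 1) * (\<xi>$1 * \<xi>$3)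
      + (c 2 3 + c 3 2) * (\<xi>$2 * \<xi>$3))"
    by (simp add: fun_eq_iff quad_fun_def sum_3 power2_eq_square algebra_simps)
  then show ?thesis
    unfolding p Q4_quad_fun by (simp only: integral_ref_tet_quadratic) (simp add: algebra_simps)
qed

lemma poly2_add: "p \<in> poly2 \<Longrightarrow> q \<in> poly2 \<Longrightarrow> (\<lambda>\<xi>. p \<xi> + q \<xi>) \<in> poly2"
proof -
  assume "p \<in> poly2" "q \<in> poly2"
  then obtain a b c a' b' c' where "p = quad_fun a b c" "q = quad_fun a' b' c'"
    by (auto simp: poly2_iff)
  then have "(\<lambda>\<xi>. p \<xi> + q \<xi>) = quad_fun (a + a') (\<lambda>i. b i + b' i) (\<lambda>i j. c i j + c' i j)"
    by (simp add: fun_eq_iff quad_fun_def sum.distrib algebra_simps)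
  then show ?thesis
    by (auto simp: poly2_iff)
qed

lemma poly2_cmult: "p \<in> poly2 \<Longrightarrow> (\<lambda>\<xi>. k * p \<xi>) \<in> poly2"
proof -
  assume "p \<in> poly2"
  then obtain a b c where "p = quad_fun a b c"
    by (auto simp: poly2_iff)
  then have "(\<lambda>\<xi>. k * p \<xi>) = quad_fun (k * a) (\<lambda>i. k * b i) (\<lambda>i j. k * c i j)"
    by (simp add: fun_eq_iff quad_fun_def sum_distrib_left algebra_simps)
  then show ?thesis
    by (auto simp: poly2_iff)
qed

lemma poly2_diff: "p \<in> poly2 \<Longrightarrow> q \<in> poly2 \<Longrightarrow> (\<lambda>\<xi>. p \<xi> - q \<xi>) \<in> poly2"
  using poly2_add[of p "\<lambda>\<xi>. - 1 * q \<xi>"] poly2_cmult[of q "- 1"] by simp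

definition affine_fun :: "(real^3 \<Rightarrow> real) \<Rightarrow> bool" where
  "affine_fun p \<longleftrightarrow> (\<exists>a b. \<forall>\<xi>. p \<xi> = a + b \<bullet> \<xi>)"

text \<open>Jacobian entries of quadratic maps are affine, so this puts each product in an entry of
  \<open>tcross\<close> into \<open>poly2\<close>.\<close>

lemma affine_fun_mult_poly2:
  assumes "affine_fun p" "affine_fun q"
  shows "(\<lambda>\<xi>. p \<xi> * q \<xi>) \<in> poly2"
proof -
  obtain a b a' b' where "p = (\<lambda>\<xi>. a + b \<bullet> \<xi>)" "q = (\<lambda>\<xi>. a' + b' \<bullet> \<xi>)"
    using assms by (auto simp: affine_fun_def fun_eq_iff)
  then have "(\<lambda>\<xi>. p \<xi> * q \<xi>)
      = quad_fun (a * a') (\<lambda>i. a * b' $ i + a' * b $ i) (\<lambda>i j. b $ i * b' $ j)"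
    by (simp add: fun_eq_iff quad_fun_def inner_vec_def sum_3 algebra_simps)
  then show ?thesis
    by (auto simp: poly2_iff)
qed

section \<open>Jacobians of quadratic maps and their midside deviations\<close>

lemma quad_fun_has_derivative:
  "(quad_fun a b c has_derivative
    (\<lambda>h. (\<Sum>i\<in>UNIV. (b i + (\<Sum>j\<in>UNIV. (c i j + c j i) * \<xi> $ j)) * h $ i))) (at \<xi>)"
  unfolding quad_fun_def[abs_def] sum_3
  by (rule derivative_eq_intros bounded_linear_imp_has_derivative[OF bounded_linear_vec_nth] refl)+
    (simp add: fun_eq_iff algebra_simps)

lemma has_derivative_vec_nth:
  fixes f :: "'a::real_normed_vector \<Rightarrow> real^'n"
  assumes "\<And>i. ((\<lambda>x. f x $ i) has_derivative (\<lambda>h. f' h $ i)) (at x)"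
  shows "(f has_derivative f') (at x)"
  unfolding has_derivative_componentwise_within[of f]
  using assms by (auto simp: Basis_vec_def inner_axis)

lemma quadratic_map_obtain:
  assumes "quadratic_map u"
  obtains a b c where "\<And>i. (\<lambda>\<xi>. u \<xi> $ i) = quad_fun (a i) (b i) (c i)"
  using assms unfolding quadratic_map_def poly2_iff by metis

lemma quadratic_map_has_derivative:
  assumes "\<And>i. (\<lambda>\<xi>. u \<xi> $ i) = quad_fun (a i) (b i) (c i)"
  shows "(u has_derivative
    (\<lambda>h. \<chi> i. \<Sum>j\<in>UNIV. (b i j + (\<Sum>k\<in>UNIV. (c i j k + c i k j) * \<xi> $ k)) * h $ j)) (at \<xi>)"
  by (rule has_derivative_vec_nth) (simp add: assms quad_fun_has_derivative)

lemma quadratic_map_differentiable: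
  assumes "quadratic_map u"
  shows "u differentiable at \<xi>"
proof -
  obtain a b c where "\<And>i. (\<lambda>\<xi>. u \<xi> $ i) = quad_fun (a i) (b i) (c i)"
    using quadratic_map_obtain[OF assms] by blast
  then show ?thesis
    by (rule differentiableI[OF quadratic_map_has_derivative])
qed

lemma jacobian_quadratic_map:
  assumes "\<And>i. (\<lambda>\<xi>. u \<xi> $ i) = quad_fun (a i) (b i) (c i)"
  shows "jacobian u (at \<xi>) $ i $ j = b i j + (\<Sum>k\<in>UNIV. (c i j k + c i k j) * \<xi> $ k)"
  using frechet_derivative_at[OF quadratic_map_has_derivative[of u a b c, OF assms], symmetric]
  by (simp add: jacobian_def matrix_def axis_def if_distrib cong: if_cong)

lemma affine_fun_jacobian:
  assumes "quadratic_map u"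
  shows "affine_fun (\<lambda>\<xi>. jacobian u (at \<xi>) $ i $ j)"
proof -
  obtain a b c where "\<And>i. (\<lambda>\<xi>. u \<xi> $ i) = quad_fun (a i) (b i) (c i)"
    using quadratic_map_obtain[OF assms] by blast
  from jacobian_quadratic_map[OF this] show ?thesis
    unfolding affine_fun_def
    by (intro exI[of _ "b i j"] exI[of _ "\<chi> k. c i j k + c i k j"]) (simp add: inner_vec_def)
qed

lemma jacobian_matrix_mult:
  fixes X :: "real^'n \<Rightarrow> real^'m" and Z :: "real^'m^'k"
  assumes "X differentiable at \<xi>"
  shows "jacobian (\<lambda>\<eta>. Z *v X \<eta>) (at \<xi>) = Z ** jacobian X (at \<xi>)"
proof -
  have "((\<lambda>\<eta>. Z *v X \<eta>) has_derivative (\<lambda>h. Z *v (jacobian X (at \<xi>) *v h))) (at \<xi>)"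
    using bounded_linear.has_derivative[OF matrix_vector_mul_bounded_linear[of Z] assms[unfolded jacobian_works]] .
  then have "((\<lambda>\<eta>. Z *v X \<eta>) has_derivative (\<lambda>h. (Z ** jacobian X (at \<xi>)) *v h)) (at \<xi>)"
    by (simp add: matrix_vector_mul_assoc)
  from frechet_derivative_at[OF this, symmetric] show ?thesis
    by (simp add: jacobian_def)
qed

text \<open>On the edge from 0 to the i-th unit vector the deviation is \<open>- c i i / 4\<close>,
  so the diagonal vanishes. The deviation on the edge joining the i-th and j-th unit vectors is then
  \<open>(c i j + c j i) / 4\<close>.\<close>

lemma quad_fun_midside:
  assumes "\<And>p q. p \<in> tet_vertices \<Longrightarrow> q \<in> tet_vertices \<Longrightarrow> p \<noteq> q \<Longrightarrow>
    quad_fun a b c (midpoint p q) = (quad_fun a b c p + quad_fun a b c q) / 2"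
  shows "c i j + c j i = 0"
proof -
  have vert: "0 \<in> tet_vertices" "axis i 1 \<in> tet_vertices" for i
    by (auto simp: tet_vertices_def)
  have diag: "c i i = 0" for i
    using assms[OF vert(1) vert(2)[of i]] zero_neq_axis[of i] exhaust_3[of i]
    by (auto simp: quad_fun_def midpoint_def axis_def sum_3)
  show ?thesis
  proof (cases "i = j")
    case False
    then have "axis i 1 \<noteq> (axis j 1 :: real^3)"
      by (simp add: axis_eq_axis)
    from False assms[OF vert(2) vert(2) this] show ?thesis
      using exhaust_3[of i] exhaust_3[of j] diag[of 1] diag[of 2] diag[of 3]
      by (auto simp: quad_fun_def midpoint_def axis_def sum_3 field_simps)
  qed (simp add: diag)
qed

text \<open>A deviation along axis \<open>k\<close> has no component \<open>i\<close>, so component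
  \<open>i\<close> of \<open>X\<close> loses its quadratic part and is affine.\<close>

lemma jacobian_row_constant:
  assumes X: "quadratic_map X" and i: "i \<noteq> k"
    and mid: "\<And>p q. p \<in> tet_vertices \<Longrightarrow> q \<in> tet_vertices \<Longrightarrow> p \<noteq> q \<Longrightarrow>
      midside_deviation X p q \<in> span {axis k 1}"
  shows "jacobian X (at \<xi>) $ i $ j = jacobian X (at 0) $ i $ j"
proof -
  obtain a b c where u: "\<And>i. (\<lambda>\<xi>. X \<xi> $ i) = quad_fun (a i) (b i) (c i)"
    using quadratic_map_obtain[OF X] by blast
  have "c i j l + c i l j = 0" for j l
  proof (rule quad_fun_midside)
    fix p q assume "p \<in> tet_vertices" "q \<in> tet_vertices" "p \<noteq> q"
    then obtain r where "midside_deviation X p q = r *\<^sub>R axis k 1"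
      using mid by (auto simp: span_singleton)
    then have "midside_deviation X p q $ i = 0"
      using i by (simp add: axis_def)
    then show "quad_fun (a i) (b i) (c i) (midpoint p q)
        = (quad_fun (a i) (b i) (c i) p + quad_fun (a i) (b i) (c i) q) / 2"
      by (simp add: midside_deviation_def fun_cong[OF u, symmetric] field_simps)
  qed
  then show ?thesis
    by (simp add: jacobian_quadratic_map[OF u])
qed

text \<open>With a constant first factor, the integrand is a combination of products of two affine
  functions, on which the rule is exact.\<close>

lemma exactly_aligned_if_constant_jacobian:
  assumes "\<And>\<xi>. jacobian (\<lambda>\<eta>. Z *v X \<eta>) (at \<xi>) = M"
  shows "exactly_aligned Z X"
proof -
  have "(\<lambda>\<xi>. frob M (tcross (jacobian u (at \<xi>)) (jacobian v (at \<xi>)))) \<in> poly2"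
    if "quadratic_map u" "quadratic_map v" for u v
    unfolding frob_eq_inner inner_matrix3 tcross_entries
    by simp (intro poly2_add poly2_diff poly2_cmult affine_fun_mult_poly2 affine_fun_jacobian that)
  then show ?thesis
    by (simp add: exactly_aligned_def assms Q4_exact_poly2)
qed

theorem proposition19:
  fixes D E12 Z :: "real^3^3" and F :: "real \<Rightarrow> real^3^3"
  assumes "D = diag3 2 2 (1/4)"
    and "E12 = outer (axis 1 1) (axis 2 1)"
    and "\<And>s. F s = D + s *\<^sub>R E12"
    and "Z = diag3 (191/4) (191/4) 0"
  shows "(\<forall>s. \<bar>s\<bar> \<le> 1/4 \<longrightarrow> (\<forall>H. H \<noteq> 0 \<longrightarrow>
             second_derivative W_MR (F s) H H + frob Z (tcross H H) > 1/5 * A1 D H H))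
       \<and> (\<forall>X. quadratic_map X \<and>
             (\<forall>p\<in>tet_vertices. \<forall>q\<in>tet_vertices. p \<noteq> q \<longrightarrow>
                midside_deviation X p q \<in> span {axis 3 1})
             \<longrightarrow> exactly_aligned Z X)"
proof (intro conjI allI impI)
  fix s :: real and H :: "real^3^3"
  assume s: "\<bar>s\<bar> \<le> 1/4" and "H \<noteq> 0"
  then have "\<not> (H$1$1 = 0 \<and> H$1$2 = 0 \<and> H$1$3 = 0 \<and> H$2$1 = 0 \<and> H$2$2 = 0 \<and> H$2$3 = 0
      \<and> H$3$1 = 0 \<and> H$3$2 = 0 \<and> H$3$3 = 0)"
    by (simp add: vec_eq_iff forall_3)
  from stability_form_pos[OF s this]
  have "second_derivative W_MR (F s) H H + frob Z (tcross H H) - 1/5 * A1 D H H > 0"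
    unfolding assms stability_form_eq .
  then show "second_derivative W_MR (F s) H H + frob Z (tcross H H) > 1/5 * A1 D H H"
    by simp
next
  fix X
  assume X: "quadratic_map X \<and> (\<forall>p\<in>tet_vertices. \<forall>q\<in>tet_vertices. p \<noteq> q \<longrightarrow>
    midside_deviation X p q \<in> span {axis 3 1})"
  have row: "jacobian X (at \<xi>) $ i $ j = jacobian X (at 0) $ i $ j" if "i \<noteq> 3" for \<xi> i j
    by (rule jacobian_row_constant[OF _ that]) (use X in auto)
  \<comment> \<open>The third diagonal entry of \<open>Z\<close> is zero, so the product discards
    the third row of the Jacobian, the only one that may vary.\<close>
  have "Z ** jacobian X (at \<xi>) = Z ** jacobian X (at 0)" for \<xi>
    using row[of 1 \<xi>] row[of 2 \<xi>]
    by (simp add: assms(4) vec_eq_iff forall_3 matrix_matrix_mult_def sum_3)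
  then show "exactly_aligned Z X"
    using X by (intro exactly_aligned_if_constant_jacobian[of _ _ "Z ** jacobian X (at 0)"])
      (simp add: jacobian_matrix_mult quadratic_map_differentiable)
qed

end
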